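(* Let $G$ be any finite simple graph. Then \[ \left|I(G;-1)\right| \le 2^{\phi_3(G)}. \]
   Context: For a finite simple graph $G$, the independence polynomial is $I(G;x)=\sum_{k\ge 0} i_k(G)x^k$, where $i_k(G)$ is the number of independent sets of $G$ of size $k$ (with $i_0(G)=1$, counting the empty set). A $\tilde{3}$-cycle is a cycle whose length is divisible by $3$. A graph is called ternary if it contains no induced $\tilde{3}$-cycle. A set $D\subseteq V(G)$ is a $\tilde{3}$-decycling set of $G$ if $G-D$ is ternary. The ternary decycling number $\phi_3(G)$ is the minimum size of a $\tilde{3}$-decycling set of $G$. *)

theory Defs
  imports Main
begin

definition simple_graph :: "'a set \<Rightarrow> ('a \<Rightarrow> 'a \<Rightarrow> bool) \<Rightarrow> bool" where
  "simple_graph V E \<longleftrightarrow> finite V \<and> (\<forall>x y. E x y \<longrightarrow> x \<in> V \<and> y \<in> V)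
     \<and> (\<forall>x y. E x y \<longrightarrow> E y x) \<and> (\<forall>x. \<not> E x x)"

definition independent_set :: "'a set \<Rightarrow> ('a \<Rightarrow> 'a \<Rightarrow> bool) \<Rightarrow> 'a set \<Rightarrow> bool" where
  "independent_set V E S \<longleftrightarrow> S \<subseteq> V \<and> (\<forall>x\<in>S. \<forall>y\<in>S. \<not> E x y)"

definition num_indep :: "'a set \<Rightarrow> ('a \<Rightarrow> 'a \<Rightarrow> bool) \<Rightarrow> nat \<Rightarrow> nat" where
  "num_indep V E k = card {S. independent_set V E S \<and> card S = k}"

definition indep_poly :: "'a set \<Rightarrow> ('a \<Rightarrow> 'a \<Rightarrow> bool) \<Rightarrow> int \<Rightarrow> int" where
  "indep_poly V E x = (\<Sum>k\<le>card V. int (num_indep V E k) * x ^ k)"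

definition induced_cycle :: "('a \<Rightarrow> 'a \<Rightarrow> bool) \<Rightarrow> 'a list \<Rightarrow> bool" where
  "induced_cycle E vs \<longleftrightarrow> distinct vs \<and> length vs \<ge> 3 \<and>
     (\<forall>i<length vs. \<forall>j<length vs.
        E (vs ! i) (vs ! j) \<longleftrightarrow> (j = (i + 1) mod length vs \<or> i = (j + 1) mod length vs))"

definition ternary :: "'a set \<Rightarrow> ('a \<Rightarrow> 'a \<Rightarrow> bool) \<Rightarrow> bool" where
  "ternary V E \<longleftrightarrow> \<not> (\<exists>vs. set vs \<subseteq> V \<and> induced_cycle E vs \<and> 3 dvd length vs)"

definition decycling3 :: "'a set \<Rightarrow> ('a \<Rightarrow> 'a \<Rightarrow> bool) \<Rightarrow> 'a set \<Rightarrow> bool" where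
  "decycling3 V E D \<longleftrightarrow> D \<subseteq> V \<and> ternary (V - D) E"

definition phi3 :: "'a set \<Rightarrow> ('a \<Rightarrow> 'a \<Rightarrow> bool) \<Rightarrow> nat" where
  "phi3 V E = Min (card ` {D. decycling3 V E D})"

end

(* Let f be the signed count of the independent sets of G. Then f^3 is the signed count of the
   triples (A_0, A_1, A_2) of independent sets. Call (x, c) flippable if x lies in A_c but not in
   A_(c+2), and no neighbour of x lies in A_(c+1), indices modulo 3. Adding x to A_(c+1), or
   removing it, changes the sign and leaves the set of flippable pairs unchanged, so only the
   triples without flippable pairs contribute. In such a triple, a vertex that lies in some but
   not all of the A_i lies in exactly one, A_c say, and has a neighbour that lies in A_(c+1) only.
   These vertices are properly 3-coloured, and every one of them has a neighbour of the next
   colour. A shortest closed walk along which the colour increases by 1 at each step is then an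
   induced cycle of length divisible by 3. If G is ternary, only the triples (A, A, A) remain;
   hence f^3 = f and |f| <= 1. The recursion f(G) = f(G - v) - f(G - N[v]) on the vertices of a
   decycling set doubles the bound at most once per vertex. *)

theory Submission
  imports Defs
begin

section \<open>Signed counts of independent sets and vertex deletion\<close>

definition indep_sum :: "('a \<Rightarrow> 'a \<Rightarrow> bool) \<Rightarrow> 'a set \<Rightarrow> int" where
  "indep_sum E W = (\<Sum>S | independent_set W E S. (-1) ^ card S)"

lemma finite_independent_sets: "finite W \<Longrightarrow> finite {S. independent_set W E S}"
  by (rule finite_subset[of _ "Pow W"]) (auto simp: independent_set_def)

lemma indep_poly_minus_one:
  assumes "finite V"
  shows "indep_poly V E (-1) = indep_sum E V"
proof -
  let ?I = "{S. independent_set V E S}"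
  have "indep_sum E V = (\<Sum>k\<le>card V. \<Sum>S\<in>{S \<in> ?I. card S = k}. (-1) ^ card S)"
    unfolding indep_sum_def
    by (rule sum.group[symmetric])
      (use assms in \<open>auto simp: finite_independent_sets independent_set_def intro: card_mono\<close>)
  also have "\<dots> = (\<Sum>k\<le>card V. \<Sum>S\<in>{S \<in> ?I. card S = k}. (-1) ^ k)"
    by (intro sum.cong) auto
  also have "\<dots> = indep_poly V E (-1)"
    by (simp add: indep_poly_def num_indep_def)
  finally show ?thesis by simp
qed

text \<open>Removing \<open>v\<close> maps the independent sets through \<open>v\<close> bijectively
  to those avoiding the closed neighbourhood of \<open>v\<close>. The size drops by one, which
  accounts for the minus sign.\<close>

lemma indep_sum_delete:
  assumes "finite W" "v \<in> W" "\<And>x. \<not> E x x" "\<And>x y. E x y \<Longrightarrow> E y x"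
  shows "indep_sum E W = indep_sum E (W - {v}) - indep_sum E (W - {v} - {y. E v y})"
proof -
  let ?I = "\<lambda>W. {S. independent_set W E S}"
  let ?J = "?I (W - {v} - {y. E v y})"
  have split: "?I W = ?I (W - {v}) \<union> insert v ` ?J"
  proof (intro equalityI subsetI)
    fix S assume S: "S \<in> ?I W"
    show "S \<in> ?I (W - {v}) \<union> insert v ` ?J"
    proof (cases "v \<in> S")
      case True
      have "S - {v} \<in> ?J" using S True by (auto simp: independent_set_def)
      then show ?thesis using True by (metis UnI2 imageI insert_Diff)
    next
      case False
      then show ?thesis using S by (auto simp: independent_set_def)
    qed
  next
    fix S assume "S \<in> ?I (W - {v}) \<union> insert v ` ?J"
    then show "S \<in> ?I W"
      using assms by (auto simp: independent_set_def)
  qed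
  have inj: "inj_on (insert v) ?J"
    by (rule inj_onI) (auto simp: independent_set_def)
  have card: "card (insert v S) = Suc (card S)" if "S \<in> ?J" for S
    using that assms(1) finite_subset[of S W] by (subst card_insert_disjoint) (auto simp: independent_set_def)
  have "indep_sum E W = indep_sum E (W - {v}) + (\<Sum>S\<in>insert v ` ?J. (-1) ^ card S)"
    unfolding indep_sum_def split
    by (rule sum.union_disjoint)
      (use assms(1) in \<open>auto simp: finite_independent_sets independent_set_def\<close>)
  also have "(\<Sum>S\<in>insert v ` ?J. (-1) ^ card S) = (\<Sum>S\<in>?J. - ((-1) ^ card S) :: int)"
    by (subst sum.reindex[OF inj]) (simp add: card)
  finally show ?thesis by (simp add: indep_sum_def sum_negf)
qed

section \<open>Induced cycles from cyclic 3-colourings\<close>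

lemma lt3_cases: "c < 3 \<Longrightarrow> c = 0 \<or> c = 1 \<or> c = (2::nat)" by linarith

text \<open>Following \<open>succ\<close> in a finite set must eventually close up. The colour
  advances by 1 modulo 3 along each arc, so every closed walk of arcs has length divisible by 3; one
  of minimal length has neither repeated vertices nor chords.\<close>

lemma induced_cycle_of_3_colouring:
  fixes E :: "'a \<Rightarrow> 'a \<Rightarrow> bool" and col :: "'a \<Rightarrow> nat"
  assumes fin: "finite S" and ne: "S \<noteq> {}"
    and irr: "\<And>x. \<not> E x x" and sym: "\<And>x y. E x y \<Longrightarrow> E y x"
    and col3: "\<And>x. x \<in> S \<Longrightarrow> col x < 3"
    and proper: "\<And>x y. x \<in> S \<Longrightarrow> y \<in> S \<Longrightarrow> E x y \<Longrightarrow> col x \<noteq> col y"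
    and succ: "\<And>x. x \<in> S \<Longrightarrow> \<exists>y\<in>S. E x y \<and> col y = (col x + 1) mod 3"
  shows "\<exists>vs. set vs \<subseteq> S \<and> induced_cycle E vs \<and> 3 dvd length vs"
proof -
  define arc where "arc x y \<longleftrightarrow> x \<in> S \<and> y \<in> S \<and> E x y \<and> col y = (col x + 1) mod 3" for x y
  define walk where "walk g n \<longleftrightarrow> n > 0 \<and> g n = g 0 \<and> (\<forall>k<n. arc (g k) (g (Suc k)))"
    for g :: "nat \<Rightarrow> 'a" and n
  have arc_or: "arc x y \<or> arc y x" if "x \<in> S" "y \<in> S" "E x y" for x y
    using proper[OF that] lt3_cases[OF col3[OF that(1)]] lt3_cases[OF col3[OF that(2)]]
      that sym[OF that(3)]
    unfolding arc_def by auto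
  have "\<exists>g n. walk g n"
  proof -
    obtain s where s: "\<And>x. x \<in> S \<Longrightarrow> arc x (s x)"
      using succ unfolding arc_def by metis
    obtain x0 where x0: "x0 \<in> S" using ne by blast
    define g where "g k = (s ^^ k) x0" for k
    have gS: "g k \<in> S" for k
      by (induction k) (use x0 s in \<open>auto simp: g_def arc_def\<close>)
    have garc: "arc (g k) (g (Suc k))" for k
      using s[OF gS[of k]] by (simp add: g_def)
    \<comment> \<open>Pigeonhole on the iterates of \<open>s\<close>: the stretch between two equal
      iterates is a closed walk.\<close>
    have "\<not> inj g"
      using fin gS by (meson finite_subset image_subsetI infinite_iff_countable_subset
          finite_imageD infinite_UNIV_nat)
    then obtain i j where ij: "i < j" "g i = g j"
      by (metis injI linorder_neqE_nat)
    have "walk (\<lambda>k. g (i + k)) (j - i)"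
      using ij garc by (auto simp: walk_def)
    then show ?thesis by blast
  qed
  then obtain n0 where "\<exists>g. walk g n0" by blast
  define n where "n = (LEAST n. \<exists>g. walk g n)"
  obtain g where g: "walk g n"
    using LeastI[of "\<lambda>n. \<exists>g. walk g n", OF \<open>\<exists>g. walk g n0\<close>] unfolding n_def by blast
  have min: "n \<le> m" if "walk h m" for h m
    unfolding n_def using that by (intro Least_le) blast
  have n0: "n > 0" and gn: "g n = g 0" and garc: "\<And>k. k < n \<Longrightarrow> arc (g k) (g (Suc k))"
    using g by (auto simp: walk_def)
  have gS: "g k \<in> S" if "k < n" for k using garc[OF that] by (simp add: arc_def)
  have colg: "k \<le> n \<Longrightarrow> col (g k) = (col (g 0) + k) mod 3" for k
  proof (induction k)
    case 0
    then show ?case using col3[OF gS[OF n0]] by simp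
  next
    case (Suc k)
    then show ?case using garc[of k] by (simp add: arc_def mod_simps)
  qed
  have dvd: "3 dvd n"
  proof -
    have "col (g 0) = (col (g 0) + n) mod 3" using colg[of n] gn by simp
    then show ?thesis using col3[OF gS[OF n0]] by presburger
  qed
  have n3: "n \<ge> 3" using dvd n0 by (auto simp: dvd_def)
  have noteq: "g i \<noteq> g j" if "i < j" "j < n" for i j
  proof
    assume "g i = g j"
    \<comment> \<open>A repeated vertex cuts out a closed walk of length \<open>j - i\<close>, which
      is less than \<open>n\<close>.\<close>
    then have "walk (\<lambda>k. g (i + k)) (j - i)"
      using that garc by (auto simp: walk_def)
    from min[OF this] show False using that by simp
  qed
  \<comment> \<open>The colours of the ends of a chord differ by 1, so the chord gives a shorter closed walk.\<close>
  have chord: "j = Suc i \<or> (i = 0 \<and> j = n - 1)" if ij: "i < j" "j < n" and e: "E (g i) (g j)" for i j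
  proof -
    have "arc (g i) (g j) \<or> arc (g j) (g i)"
      using arc_or[OF gS gS e] ij by simp
    then show ?thesis
    proof
      assume a: "arc (g i) (g j)"
      \<comment> \<open>The walk \<open>h\<close> follows \<open>g\<close> up to \<open>i\<close>,
        jumps along the chord to \<open>g j\<close> and continues to \<open>g n = g 0\<close>. Its
        length \<open>Suc i + (n - j)\<close> is at least \<open>n\<close> only if
        \<open>j = Suc i\<close>.\<close>
      define h where "h k = (if k \<le> i then g k else g (k - Suc i + j))" for k
      have "arc (h k) (h (Suc k))" if k: "k < Suc i + (n - j)" for k
      proof -
        consider "k < i" | "k = i" | "k > i" by linarith
        then show ?thesis
        proof cases
          case 3
          then have "h k = g (k - Suc i + j)" "h (Suc k) = g (Suc (k - Suc i + j))"
            by (auto simp: h_def Suc_diff_Suc simp flip: add_Suc)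
          then show ?thesis using garc[of "k - Suc i + j"] 3 k ij by simp
        qed (use a garc[of k] ij in \<open>auto simp: h_def\<close>)
      qed
      then have "walk h (Suc i + (n - j))"
        using ij gn by (auto simp: walk_def h_def)
      from min[OF this] show ?thesis using ij by linarith
    next
      assume a: "arc (g j) (g i)"
      \<comment> \<open>A backward chord closes the stretch from \<open>g i\<close> to
        \<open>g j\<close>. The length \<open>Suc (j - i)\<close> is at least \<open>n\<close> only
        for \<open>i = 0\<close> and \<open>j = n - 1\<close>, where the chord is the closing
        edge.\<close>
      have "walk (\<lambda>k. if k \<le> j - i then g (i + k) else g i) (Suc (j - i))"
        using ij a garc by (auto simp: walk_def le_Suc_eq less_Suc_eq)
      from min[OF this] show ?thesis using ij by linarith
    qed
  qed
  have next_edge: "E (g i) (g ((i + 1) mod n))" if "i < n" for i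
  proof (cases "Suc i = n")
    case True
    then show ?thesis using garc[OF that] gn by (simp add: arc_def)
  next
    case False
    then show ?thesis using garc[OF that] that by (simp add: arc_def)
  qed
  define vs where "vs = map g [0..<n]"
  have len: "length vs = n" and nth: "\<And>i. i < n \<Longrightarrow> vs ! i = g i"
    by (auto simp: vs_def)
  have "distinct vs"
    unfolding distinct_conv_nth len using noteq nth by (metis linorder_neqE_nat)
  moreover have "E (g i) (g j) \<longleftrightarrow> j = (i + 1) mod n \<or> i = (j + 1) mod n" (is "?l i j \<longleftrightarrow> ?r i j")
    if ij: "i < n" "j < n" for i j
  proof
    assume "?r i j"
    then show "?l i j" using next_edge ij sym by auto
  next
    assume l: "?l i j"
    have *: "?r i j" if "i < j" "j < n" "?l i j" for i j
      using chord[OF that] that n3 by auto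
    consider "i < j" | "j < i" | "i = j" by linarith
    then show "?r i j"
      by cases (use *[of i j] *[of j i] l sym[OF l] irr ij in auto)
  qed
  ultimately have "induced_cycle E vs"
    using n3 by (auto simp: induced_cycle_def len nth)
  moreover have "set vs \<subseteq> S" using gS by (auto simp: vs_def)
  ultimately show ?thesis using dvd len by metis
qed

section \<open>A sign-reversing involution on triples of independent sets\<close>

text \<open>A triple of independent sets is encoded as a set of pairs (vertex, index of the set).\<close>

definition layered :: "('a \<Rightarrow> 'a \<Rightarrow> bool) \<Rightarrow> 'a set \<Rightarrow> ('a \<times> nat) set \<Rightarrow> bool" where
  "layered E W P \<longleftrightarrow> P \<subseteq> W \<times> {..<3} \<and> (\<forall>x y c. (x, c) \<in> P \<longrightarrow> (y, c) \<in> P \<longrightarrow> \<not> E x y)"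

text \<open>The clause on layer \<open>c + 2\<close> keeps toggling \<open>(x, c + 1)\<close> from
  affecting \<open>(x, c + 2)\<close>, whose own next-but-one layer is \<open>c + 1\<close>. It also
  makes every pair of a triple \<open>(A, A, A)\<close> unflippable.\<close>

definition flippable :: "('a \<Rightarrow> 'a \<Rightarrow> bool) \<Rightarrow> ('a \<times> nat) set \<Rightarrow> ('a \<times> nat) set" where
  "flippable E P = {(x, c). (x, c) \<in> P \<and> (x, (c + 2) mod 3) \<notin> P \<and>
     (\<forall>y. E x y \<longrightarrow> (y, (c + 1) mod 3) \<notin> P)}"

definition flip :: "('a \<times> nat) set \<Rightarrow> 'a \<times> nat \<Rightarrow> ('a \<times> nat) set" where
  "flip P = (\<lambda>(x, c). if (x, (c + 1) mod 3) \<in> P then P - {(x, (c + 1) mod 3)}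
     else insert (x, (c + 1) mod 3) P)"

lemma finite_layered: "finite W \<Longrightarrow> finite {P. layered E W P}"
  by (rule finite_subset[of _ "Pow (W \<times> {..<3})"]) (auto simp: layered_def)

text \<open>For \<open>q = (x, c)\<close> only \<open>(x, c + 1)\<close> is toggled. That pair is
  never flippable, since \<open>(x, c)\<close> stays present. For a vertex \<open>y\<close> other
  than \<open>x\<close>, only the pair \<open>(y, c)\<close> with \<open>y\<close> adjacent to
  \<open>x\<close> could be affected, but it is absent because layer \<open>c\<close> is independent
  and contains \<open>x\<close>.\<close>

lemma flip_properties:
  assumes P: "layered E W P" and q: "q \<in> flippable E P"
    and irr: "\<And>x. \<not> E x x" and sym: "\<And>x y. E x y \<Longrightarrow> E y x" and fin: "finite W"
  shows "layered E W (flip P q)" "flippable E (flip P q) = flippable E P"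
    "flip (flip P q) q = P" "(-1) ^ card (flip P q) = - ((-1) ^ card P :: int)"
proof -
  obtain x c where qe: "q = (x, c)" by force
  have x: "(x, c) \<in> P" "(x, (c + 2) mod 3) \<notin> P" "\<And>y. E x y \<Longrightarrow> (y, (c + 1) mod 3) \<notin> P"
    using q by (auto simp: qe flippable_def)
  have c3: "c < 3" and xW: "x \<in> W" using x(1) P by (auto simp: layered_def)
  let ?p = "(x, (c + 1) mod 3)"
  have memb: "r \<in> flip P q \<longleftrightarrow> (if r = ?p then ?p \<notin> P else r \<in> P)" for r
    by (auto simp: flip_def qe)
  show "layered E W (flip P q)"
    unfolding layered_def
  proof (intro conjI allI impI)
    show "flip P q \<subseteq> W \<times> {..<3}"
      using P xW by (auto simp: flip_def qe layered_def split: if_splits)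
  next
    fix y z d assume "(y, d) \<in> flip P q" "(z, d) \<in> flip P q"
    then show "\<not> E y z"
      using P x(3) irr sym unfolding memb layered_def by (auto split: if_splits)
  qed
  have "(y, d) \<in> flippable E (flip P q) \<longleftrightarrow> (y, d) \<in> flippable E P" for y d
  proof (cases "d < 3")
    case False
    then have "(y, d) \<notin> flip P q" "(y, d) \<notin> P"
      using \<open>layered E W (flip P q)\<close> P by (auto simp: layered_def)
    then show ?thesis by (simp add: flippable_def)
  next
    case d3: True
    show ?thesis
    proof (cases "y = x")
      case True
      have c: "c \<noteq> (c + 1) mod 3" "(c + 2) mod 3 \<noteq> (c + 1) mod 3"
        "((c + 1) mod 3 + 2) mod 3 = c" "d = c \<or> d = (c + 1) mod 3 \<or> d = (c + 2) mod 3"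
        using lt3_cases[OF c3] lt3_cases[OF d3] by auto
      from c(4) show ?thesis
      proof (elim disjE)
        assume "d = c"
        then show ?thesis using c irr x True by (auto simp: flippable_def memb)
      next
        assume d: "d = (c + 1) mod 3"
        have "(x, c) \<in> flip P q" using x(1) c(1) by (simp add: memb)
        then show ?thesis using d c(3) x(1) True by (simp add: flippable_def)
      next
        assume d: "d = (c + 2) mod 3"
        have "(x, d) \<notin> flip P q" using x(2) c(2) d by (simp add: memb)
        then show ?thesis using d x(2) True by (simp add: flippable_def)
      qed
    next
      case False
      have "\<not> E y x" if "(y, c) \<in> P" using that x(1) P by (auto simp: layered_def)
      moreover have "(d + 1) mod 3 = (c + 1) mod 3 \<longleftrightarrow> d = c"
        using lt3_cases[OF c3] lt3_cases[OF d3] by auto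
      ultimately show ?thesis
        using False by (auto simp: flippable_def memb)
    qed
  qed
  then show "flippable E (flip P q) = flippable E P" by auto
  show "flip (flip P q) q = P" by (auto simp: flip_def qe)
  have "finite P" using P fin finite_subset[of P "W \<times> {..<3}"] by (simp add: layered_def)
  show "(-1) ^ card (flip P q) = - ((-1) ^ card P :: int)"
  proof (cases "?p \<in> P")
    case True
    have "card P = Suc (card (P - {?p}))"
      by (rule card.remove) fact+
    then have "(-1) ^ card P = - ((-1) ^ card (P - {?p}) :: int)"
      by (metis power_Suc mult_minus1)
    moreover have "flip P q = P - {?p}" using True by (simp add: flip_def qe)
    ultimately show ?thesis by simp
  next
    case False
    then show ?thesis using \<open>finite P\<close> by (simp add: flip_def qe)
  qed
qed

text \<open>The sizes of the three layers add up, so their signs multiply and the sum over triples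
  factors.\<close>

lemma sum_layered_eq_cube:
  assumes fin: "finite W"
  shows "(\<Sum>P | layered E W P. (-1) ^ card P) = indep_sum E W ^ 3"
proof -
  let ?I = "{S. independent_set W E S}"
  let ?s = "\<lambda>S. (-1) ^ card S :: int"
  let ?f = "\<lambda>(A, B, C). A \<times> {0::nat} \<union> B \<times> {1} \<union> C \<times> {2}"
  let ?g = "\<lambda>P. ({x. (x, 0::nat) \<in> P}, {x. (x, 1) \<in> P}, {x. (x, 2) \<in> P})"
  have fI: "finite S" if "independent_set W E S" for S
    using that fin finite_subset[of S W] by (simp add: independent_set_def)
  have "indep_sum E W ^ 3 = (\<Sum>A\<in>?I. \<Sum>B\<in>?I. \<Sum>C\<in>?I. ?s A * (?s B * ?s C))"
    by (simp add: indep_sum_def power3_eq_cube mult.assoc flip: sum_distrib_left sum_distrib_right)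
  also have "\<dots> = (\<Sum>(A, B, C)\<in>?I \<times> ?I \<times> ?I. ?s A * (?s B * ?s C))"
    by (simp add: sum.cartesian_product)
  also have "\<dots> = (\<Sum>P | layered E W P. ?s P)"
  proof (rule sum.reindex_bij_witness[where i = ?g and j = ?f])
    fix t assume t: "t \<in> ?I \<times> ?I \<times> ?I"
    then obtain A B C where [simp]: "t = (A, B, C)"
      and ABC: "independent_set W E A" "independent_set W E B" "independent_set W E C" by auto
    show "?g (?f t) = t" by auto
    show "?f t \<in> {P. layered E W P}"
      using ABC by (auto simp: layered_def independent_set_def)
    have "card (?f t) = card A + card B + card C"
      using fI[OF ABC(1)] fI[OF ABC(2)] fI[OF ABC(3)]
      by (simp add: card_Un_disjoint card_cartesian_product disjoint_iff)
    then show "?s (?f t) = (case t of (A, B, C) \<Rightarrow> ?s A * (?s B * ?s C))"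
      by (simp add: power_add)
  next
    fix P assume P: "P \<in> {P. layered E W P}"
    then have "c = 0 \<or> c = 1 \<or> c = 2" if "(x, c) \<in> P" for x c
      using that lt3_cases by (auto simp: layered_def)
    then show "?f (?g P) = P" by auto
    show "?g P \<in> ?I \<times> ?I \<times> ?I"
      using P by (auto simp: layered_def independent_set_def)
  qed
  finally show ?thesis by simp
qed

text \<open>Vertices lying in exactly one layer would form a set \<open>S\<close> coloured by layer
  in which each vertex has a neighbour of the next colour, hence would contain a forbidden cycle.
  Lying in exactly two layers is impossible.\<close>

lemma unflippable_layered:
  assumes P: "layered E W P" and unfl: "flippable E P = {}"
    and tern: "ternary W E" and fin: "finite W"
    and irr: "\<And>x. \<not> E x x" and sym: "\<And>x y. E x y \<Longrightarrow> E y x"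
  shows "P = fst ` P \<times> {..<3}"
proof -
  define S where "S = {x. \<exists>!c. (x, c) \<in> P}"
  define col where "col x = (THE c. (x, c) \<in> P)" for x
  have P3: "c < 3" "x \<in> W" if "(x, c) \<in> P" for x c using P that by (auto simp: layered_def)
  have stable: "\<not> E x y" if "(x, c) \<in> P" "(y, c) \<in> P" for x y c
    using P that by (auto simp: layered_def)
  have nofl: "(x, (c + 2) mod 3) \<in> P \<or> (\<exists>y. E x y \<and> (y, (c + 1) mod 3) \<in> P)"
    if "(x, c) \<in> P" for x c
    using unfl that by (auto simp: flippable_def)
  have full_or_single: "(\<forall>d<3. (x, d) \<in> P) \<or> x \<in> S" if xc: "(x, c) \<in> P" for x c
  proof (rule ccontr)
    assume *: "\<not> ?thesis"
    then obtain d where d: "(x, d) \<in> P" "d \<noteq> c" using xc unfolding S_def by blast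
    obtain e where e: "e < 3" "(x, e) \<notin> P" using * by blast
    \<comment> \<open>Here \<open>x\<close> lies in layers \<open>e + 1\<close> and
      \<open>e + 2\<close> but misses \<open>e\<close>. Since \<open>(x, e + 1)\<close> is
      unflippable, \<open>x\<close> has a neighbour in layer \<open>e + 2\<close>, which also
      contains \<open>x\<close>.\<close>
    have "c \<noteq> e" "d \<noteq> e" using xc d e by auto
    then have "c = (e + 1) mod 3 \<and> d = (e + 2) mod 3 \<or> c = (e + 2) mod 3 \<and> d = (e + 1) mod 3"
      using d(2) lt3_cases[OF e(1)] lt3_cases[OF P3(1)[OF d(1)]] lt3_cases[OF P3(1)[OF xc]] by auto
    then have "(x, (e + 1) mod 3) \<in> P" "(x, (e + 2) mod 3) \<in> P"
      using d(1) xc by auto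
    moreover have "(e + 1 + 2) mod 3 = e" using e by simp
    ultimately obtain y where "E x y" "(y, (e + 2) mod 3) \<in> P"
      using nofl[of x "(e + 1) mod 3"] e by (auto simp: mod_simps)
    then show False using stable \<open>(x, (e + 2) mod 3) \<in> P\<close> by blast
  qed
  have colI: "(x, col x) \<in> P" if "x \<in> S" for x
    using that unfolding S_def col_def by (auto intro: theI')
  have colU: "c = col x" if "x \<in> S" "(x, c) \<in> P" for x c
    using that colI[OF that(1)] unfolding S_def by blast
  have "S = {}"
  proof (rule ccontr)
    assume ne: "S \<noteq> {}"
    have SW: "S \<subseteq> W" using colI P3 by blast
    have "\<exists>vs. set vs \<subseteq> S \<and> induced_cycle E vs \<and> 3 dvd length vs"
    proof (rule induced_cycle_of_3_colouring[where col = col])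
      show "finite S" using SW fin finite_subset by blast
      show "S \<noteq> {}" by fact
      show "\<not> E x x" for x by fact
      show "E y x" if "E x y" for x y by (rule sym) fact
      show "col x < 3" if "x \<in> S" for x using colI[OF that] P3 by blast
      show "col x \<noteq> col y" if "x \<in> S" "y \<in> S" "E x y" for x y
        using colI[OF that(1)] colI[OF that(2)] stable that(3) by metis
      show "\<exists>y\<in>S. E x y \<and> col y = (col x + 1) mod 3" if x: "x \<in> S" for x
      proof -
        have c3: "col x < 3" using colI[OF x] P3 by blast
        then have "(col x + 2) mod 3 \<noteq> col x" using lt3_cases by force
        then have "(x, (col x + 2) mod 3) \<notin> P" using colU[OF x] by metis
        then obtain y where y: "E x y" "(y, (col x + 1) mod 3) \<in> P"
          using nofl[OF colI[OF x]] by blast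
        \<comment> \<open>As \<open>y\<close> misses the layer of its neighbour \<open>x\<close>, it
          does not lie in all three layers, so it belongs to \<open>S\<close>.\<close>
        have "(y, col x) \<notin> P" using stable[OF colI[OF x]] y(1) by blast
        then have "y \<in> S" using full_or_single[OF y(2)] c3 by blast
        then show ?thesis using y colU by metis
      qed
    qed
    then show False using tern SW unfolding ternary_def by blast
  qed
  then show ?thesis using full_or_single P3 by force
qed

text \<open>Flippable triples cancel in pairs; the surviving triples \<open>(A, A, A)\<close> carry
  the sign of \<open>A\<close>, because tripling a size preserves its parity.\<close>

lemma indep_sum_cube:
  assumes tern: "ternary W E" and fin: "finite W"
    and irr: "\<And>x. \<not> E x x" and sym: "\<And>x y. E x y \<Longrightarrow> E y x"
  shows "indep_sum E W ^ 3 = indep_sum E W"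
proof -
  let ?s = "\<lambda>P. (-1) ^ card P :: int"
  let ?L = "{P. layered E W P}"
  let ?F = "{P \<in> ?L. flippable E P \<noteq> {}}" and ?U = "{P \<in> ?L. flippable E P = {}}"
  let ?t = "\<lambda>P. flip P (SOME q. q \<in> flippable E P)"
  have t: "layered E W (?t P)" "flippable E (?t P) = flippable E P" "?t (?t P) = P" "?s (?t P) = - ?s P"
    if "P \<in> ?F" for P
  proof -
    \<comment> \<open>The chosen pair depends only on \<open>flippable E P\<close>, which the flip
      preserves, so the same pair is chosen again and \<open>?t\<close> is an involution.\<close>
    have "(SOME q. q \<in> flippable E P) \<in> flippable E P"
      using that by (simp add: some_in_eq)
    then show "layered E W (?t P)" "flippable E (?t P) = flippable E P" "?t (?t P) = P" "?s (?t P) = - ?s P"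
      using that flip_properties[of E W P, OF _ _ irr sym fin] by auto
  qed
  have "(\<Sum>P\<in>?F. ?s P) = (\<Sum>P\<in>?F. - ?s P)"
    by (rule sum.reindex_bij_witness[where i = ?t and j = ?t]) (use t in auto)
  then have F0: "(\<Sum>P\<in>?F. ?s P) = 0" by (simp add: sum_negf)
  have "(\<Sum>P\<in>?U. ?s P) = indep_sum E W"
    unfolding indep_sum_def
  proof (rule sum.reindex_bij_witness[where i = "\<lambda>A. A \<times> {..<3}" and j = "\<lambda>P. fst ` P"])
    fix P assume "P \<in> ?U"
    then have P: "layered E W P" and eq: "P = fst ` P \<times> {..<3}"
      using unflippable_layered[OF _ _ tern fin irr sym] by auto
    show "fst ` P \<times> {..<3} = P" using eq by simp
    show "fst ` P \<in> {S. independent_set W E S}"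
      unfolding independent_set_def mem_Collect_eq
    proof (intro conjI ballI)
      show "fst ` P \<subseteq> W" using P by (auto simp: layered_def)
      fix x y assume "x \<in> fst ` P" "y \<in> fst ` P"
      then have "(x, 0) \<in> P" "(y, 0) \<in> P" using eq by (metis SigmaI lessThan_iff zero_less_numeral)+
      then show "\<not> E x y" using P by (auto simp: layered_def)
    qed
    have "card P = 3 * card (fst ` P)" by (subst eq) (simp add: card_cartesian_product)
    then show "?s (fst ` P) = ?s P" by (simp add: power_mult)
  next
    fix A assume A: "A \<in> {S. independent_set W E S}"
    show "fst ` (A \<times> {..<3::nat}) = A" by (simp add: lessThan_empty_iff)
    show "A \<times> {..<3} \<in> ?U"
      using A by (auto simp: independent_set_def layered_def flippable_def)
  qed
  moreover have "(\<Sum>P\<in>?L. ?s P) = (\<Sum>P\<in>?F. ?s P) + (\<Sum>P\<in>?U. ?s P)"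
    by (subst sum.union_disjoint[symmetric])
      (use finite_layered[OF fin] in \<open>auto intro!: sum.cong\<close>)
  ultimately show ?thesis
    using F0 sum_layered_eq_cube[OF fin, of E] by simp
qed

section \<open>From ternary graphs to the bound by the decycling number\<close>

lemma abs_indep_sum_ternary:
  assumes "ternary W E" "finite W" "\<And>x. \<not> E x x" "\<And>x y. E x y \<Longrightarrow> E y x"
  shows "\<bar>indep_sum E W\<bar> \<le> 1"
proof -
  let ?f = "indep_sum E W"
  have "?f * (?f - 1) * (?f + 1) = 0"
    using indep_sum_cube[OF assms] by (simp add: algebra_simps power3_eq_cube)
  then show ?thesis by auto
qed

lemma ternary_subset: "ternary W E \<Longrightarrow> U \<subseteq> W \<Longrightarrow> ternary U E"
  unfolding ternary_def by blast

text \<open>Each vertex of \<open>D\<close> splits the sum into two terms to which the smaller set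
  applies. Deleting a closed neighbourhood may also remove members of \<open>D\<close>, so the
  induction runs over all \<open>W\<close> and lets \<open>D\<close> reach outside
  \<open>W\<close>.\<close>

lemma abs_indep_sum_decycling:
  assumes "finite D" "finite W" "ternary (W - D) E"
    and irr: "\<And>x. \<not> E x x" and sym: "\<And>x y. E x y \<Longrightarrow> E y x"
  shows "\<bar>indep_sum E W\<bar> \<le> 2 ^ card D"
  using assms(1-3)
proof (induction D arbitrary: W rule: finite_induct)
  case empty
  then show ?case using abs_indep_sum_ternary[where E = E, OF _ _ irr sym] by simp
next
  case (insert d D)
  show ?case
  proof (cases "d \<in> W")
    case True
    have "ternary (W - {d} - D) E" "ternary (W - {d} - {y. E d y} - D) E"
      using insert.prems(2) by (auto elim!: ternary_subset)
    then have "\<bar>indep_sum E (W - {d})\<bar> \<le> 2 ^ card D"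
      "\<bar>indep_sum E (W - {d} - {y. E d y})\<bar> \<le> 2 ^ card D"
      using insert.IH insert.prems(1) by auto
    moreover have "indep_sum E W = indep_sum E (W - {d}) - indep_sum E (W - {d} - {y. E d y})"
      by (rule indep_sum_delete[where E = E, OF insert.prems(1) True irr sym])
    ultimately show ?thesis using insert.hyps by simp
  next
    case False
    then have "\<bar>indep_sum E W\<bar> \<le> 2 ^ card D"
      using insert.IH[of W] insert.prems by simp
    then show ?thesis using insert.hyps by simp
  qed
qed

theorem theorem1p5:
  fixes V :: "'a set" and E :: "'a \<Rightarrow> 'a \<Rightarrow> bool"
  assumes "simple_graph V E"
  shows "\<bar>indep_poly V E (-1)\<bar> \<le> 2 ^ phi3 V E"
proof -
  have fin: "finite V" and irr: "\<And>x. \<not> E x x" and sym: "\<And>x y. E x y \<Longrightarrow> E y x"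
    using assms by (auto simp: simple_graph_def)
  \<comment> \<open>Nonemptiness ensures that the \<open>Min\<close> in \<open>phi3\<close> is
    attained by some decycling set.\<close>
  have "decycling3 V E V"
    by (auto simp: decycling3_def ternary_def induced_cycle_def)
  moreover have "finite {D. decycling3 V E D}"
    by (rule finite_subset[of _ "Pow V"]) (use fin in \<open>auto simp: decycling3_def\<close>)
  ultimately have "phi3 V E \<in> card ` {D. decycling3 V E D}"
    unfolding phi3_def by (intro Min_in) auto
  then obtain D where D: "decycling3 V E D" "phi3 V E = card D" by auto
  then have "\<bar>indep_sum E V\<bar> \<le> 2 ^ card D"
    using fin finite_subset[of D V]
    by (intro abs_indep_sum_decycling[where E = E, OF _ _ _ irr sym]) (auto simp: decycling3_def)
  then show ?thesis using D fin by (simp add: indep_poly_minus_one)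
qed

end
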